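(* Let $\mathbf{k}$ be a commutative ring with unit. Let $\Theta:\mathbf{k}\mathcal{F}\to H_{\rm LR}^{\epsilon}$ be the unique isomorphism of unitary associative algebras $(\mathbf{k}\mathcal{F},\cdot,\mathbf{1})\to(H_{\rm LR}^{\epsilon},\backslash,|)$ such that $\Theta(B^+(F))=\Theta(F)\vee|$ for all $F\in\mathcal{F}$. Then $$\Theta:(\mathbf{k}\mathcal{F},\cdot,\mathbf{1},\Delta_{\rm RT}^{\epsilon})\longrightarrow(H_{\rm LR}^{\epsilon},\backslash,|,\Delta_{\rm LR}^{\epsilon})$$ is an isomorphism of unitary infinitesimal bialgebras.
   Context: All modules, algebras, tensor products and linear maps are over $\mathbf{k}$. Planar binary trees: a planar binary tree is a finite rooted planar tree in which every internal vertex has exactly two ordered incoming branches (left and right). The trivial tree, with no internal vertices, is denoted $|$. Let $\mathcal{Y}$ be the set of planar binary trees and $H_{\rm LR}^{\epsilon}:=\mathbf{k}\mathcal{Y}$ the free $\mathbf{k}$-module on it. Grafting: for $T_l,T_r\in\mathcal{Y}$, $T_l\vee T_r$ is the tree obtained by creating a new root with left branch $T_l$ and right branch $T_r$; $\vee$ is extended bilinearly. Every $T\in\mathcal{Y}$ with $T\neq |$ is uniquely of the form $T=T_l\vee T_r$. Under product: the bilinear map $\backslash$ on $H_{\rm LR}^{\epsilon}$ where, for trees $S,T$, $S\backslash T$ is obtained by adjoining the root of $T$ to the rightmost branch of $S$; recursively, $|\backslash T=T$ and $(S_l\vee S_r)\backslash T=S_l\vee(S_r\backslash T)$. The unit is $|$.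 Infinitesimal coproduct on binary trees: the linear map $\Delta_{\rm LR}^{\epsilon}:H_{\rm LR}^{\epsilon}\to H_{\rm LR}^{\epsilon}\otimes H_{\rm LR}^{\epsilon}$ defined on trees recursively by $\Delta_{\rm LR}^{\epsilon}(|)=0$ and $$\Delta_{\rm LR}^{\epsilon}(T_l\vee T_r)=T_l\otimes T_r+(\mathrm{id}\otimes\vee)(\Delta_{\rm LR}^{\epsilon}(T_l)\otimes T_r)+(\vee\otimes\mathrm{id})(T_l\otimes\Delta_{\rm LR}^{\epsilon}(T_r)).$$ Planar rooted forests: $\mathcal{F}$ is the set of planar rooted forests, i.e. finite (possibly empty) ordered sequences $t_1\cdots t_m$ of planar rooted trees (with arbitrary numbers of children, ordered); $\mathbf{1}$ is the empty forest and $\cdot$ is concatenation, extended bilinearly to $\mathbf{k}\mathcal{F}$. The operator $B^+$ sends a forest to the planar rooted tree obtained by grafting its roots, in order, to a new common root; it is extended linearly. Every planar rooted tree is uniquely $B^+(F)$ with $F\in\mathcal{F}$. The rooted-forest infinitesimal coproduct $\Delta_{\rm RT}^{\epsilon}:\mathbf{k}\mathcal{F}\to\mathbf{k}\mathcal{F}\otimes\mathbf{k}\mathcal{F}$ is the linear map determined by $\Delta_{\rm RT}^{\epsilon}(\mathbf{1})=0$, $\Delta_{\rm RT}^{\epsilon}(B^+(F))=F\otimes\mathbf{1}+(\mathrm{id}\otimes B^+)\Delta_{\rm RT}^{\epsilon}(F)$, and $\Delta_{\rm RT}^{\epsilon}(FG)=F\cdot\Delta_{\rm RT}^{\epsilon}(G)+\Delta_{\rm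 RT}^{\epsilon}(F)\cdot G$ for all $F,G\in\mathbf{k}\mathcal{F}$; it is known that $(\mathbf{k}\mathcal{F},\cdot,\mathbf{1},\Delta_{\rm RT}^{\epsilon})$ is a unitary infinitesimal bialgebra. A unitary infinitesimal bialgebra (of weight zero) is a quadruple $(A,\cdot,1_A,\Delta)$ where $(A,\cdot,1_A)$ is a unitary associative algebra and $\Delta:A\to A\otimes A$ is a coassociative linear map (a counit is not required) such that $\Delta(ab)=a\cdot\Delta(b)+\Delta(a)\cdot b$ for all $a,b\in A$, where $a\cdot(u\otimes v)=(au)\otimes v$ and $(u\otimes v)\cdot b=u\otimes(vb)$. An isomorphism of unitary infinitesimal bialgebras is an isomorphism $\Theta$ of unitary algebras with $(\Theta\otimes\Theta)\Delta=\Delta'\Theta$, where $\Delta$ and $\Delta'$ are the coproducts of source and target. *)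

theory Defs
  imports "HOL-Library.Poly_Mapping"
begin

section \<open>Free modules, linear maps and tensor products\<close>

text \<open>
  The free \<open>k\<close>-module on a set \<open>X\<close> (here: on a type) is the type \<open>X \<Rightarrow>\<^sub>0 k\<close> of finitely
  supported functions. Commutative rings with unit are given by the sort
  \<open>{comm_ring, comm_monoid_mult}\<close>, which, unlike \<open>comm_ring_1\<close>, does not impose \<open>0 \<noteq> 1\<close>.
\<close>

definition scale :: "'k::{comm_ring,comm_monoid_mult} \<Rightarrow> ('a \<Rightarrow>\<^sub>0 'k) \<Rightarrow> ('a \<Rightarrow>\<^sub>0 'k)"
  where "scale c p = Poly_Mapping.map ((*) c) p"

definition basis :: "'a \<Rightarrow> ('a \<Rightarrow>\<^sub>0 'k::{comm_ring,comm_monoid_mult})"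
  where "basis a = Poly_Mapping.single a 1"

definition klinear ::
    "(('a \<Rightarrow>\<^sub>0 'k::{comm_ring,comm_monoid_mult}) \<Rightarrow> ('b \<Rightarrow>\<^sub>0 'k)) \<Rightarrow> bool"
  where "klinear f \<longleftrightarrow>
    (\<forall>p q. f (p + q) = f p + f q) \<and> (\<forall>c p. f (scale c p) = scale c (f p))"

definition kbilinear ::
    "(('a \<Rightarrow>\<^sub>0 'k::{comm_ring,comm_monoid_mult}) \<Rightarrow> ('b \<Rightarrow>\<^sub>0 'k) \<Rightarrow> ('c \<Rightarrow>\<^sub>0 'k)) \<Rightarrow> bool"
  where "kbilinear f \<longleftrightarrow> (\<forall>p. klinear (f p)) \<and> (\<forall>q. klinear (\<lambda>p. f p q))"

definition lin_ext ::
    "('a \<Rightarrow> ('b \<Rightarrow>\<^sub>0 'k)) \<Rightarrow> ('a \<Rightarrow>\<^sub>0 'k::{comm_ring,comm_monoid_mult}) \<Rightarrow> ('b \<Rightarrow>\<^sub>0 'k)"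
  where "lin_ext f p = (\<Sum>a\<in>Poly_Mapping.keys p. scale (Poly_Mapping.lookup p a) (f a))"

definition bilin_ext ::
    "('a \<Rightarrow> 'b \<Rightarrow> ('c \<Rightarrow>\<^sub>0 'k)) \<Rightarrow> ('a \<Rightarrow>\<^sub>0 'k::{comm_ring,comm_monoid_mult}) \<Rightarrow> ('b \<Rightarrow>\<^sub>0 'k)
      \<Rightarrow> ('c \<Rightarrow>\<^sub>0 'k)"
  where "bilin_ext f p q = lin_ext (\<lambda>a. lin_ext (f a) q) p"

text \<open>
  The tensor product of the free modules on \<open>X\<close> and \<open>Y\<close> is the free module on \<open>X \<times> Y\<close>, where
  the pair \<open>(x, y)\<close> stands for the pure tensor of the basis elements \<open>x\<close> and \<open>y\<close>.
\<close>

definition tensor ::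
    "('a \<Rightarrow>\<^sub>0 'k::{comm_ring,comm_monoid_mult}) \<Rightarrow> ('b \<Rightarrow>\<^sub>0 'k) \<Rightarrow> ('a \<times> 'b \<Rightarrow>\<^sub>0 'k)"  (infixr "\<otimes>" 75)
  where "tensor = bilin_ext (\<lambda>a b. basis (a, b))"

text \<open>The tensor product of two linear maps; not meaningful if \<open>f\<close> or \<open>g\<close> is not linear.\<close>

definition tensor_map ::
    "(('a \<Rightarrow>\<^sub>0 'k::{comm_ring,comm_monoid_mult}) \<Rightarrow> ('c \<Rightarrow>\<^sub>0 'k)) \<Rightarrow> (('b \<Rightarrow>\<^sub>0 'k) \<Rightarrow> ('d \<Rightarrow>\<^sub>0 'k))
      \<Rightarrow> ('a \<times> 'b \<Rightarrow>\<^sub>0 'k) \<Rightarrow> ('c \<times> 'd \<Rightarrow>\<^sub>0 'k)"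
  where "tensor_map f g = lin_ext (\<lambda>(a, b). f (basis a) \<otimes> g (basis b))"

text \<open>The canonical identifications of the two triple tensor products.\<close>

definition assoc_r ::
    "(('a \<times> 'b) \<times> 'c \<Rightarrow>\<^sub>0 'k::{comm_ring,comm_monoid_mult}) \<Rightarrow> ('a \<times> ('b \<times> 'c) \<Rightarrow>\<^sub>0 'k)"
  where "assoc_r = lin_ext (\<lambda>((a, b), c). basis (a, (b, c)))"

definition assoc_l ::
    "('a \<times> ('b \<times> 'c) \<Rightarrow>\<^sub>0 'k::{comm_ring,comm_monoid_mult}) \<Rightarrow> (('a \<times> 'b) \<times> 'c \<Rightarrow>\<^sub>0 'k)"
  where "assoc_l = lin_ext (\<lambda>(a, (b, c)). basis ((a, b), c))"


section \<open>Unitary infinitesimal bialgebras\<close>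

locale unitary_algebra =
  fixes mult :: "('a \<Rightarrow>\<^sub>0 'k::{comm_ring,comm_monoid_mult}) \<Rightarrow> ('a \<Rightarrow>\<^sub>0 'k) \<Rightarrow> ('a \<Rightarrow>\<^sub>0 'k)"
    and unit :: "'a \<Rightarrow>\<^sub>0 'k"
  assumes bilinear: "kbilinear mult"
    and assoc: "mult (mult a b) c = mult a (mult b c)"
    and unit_left: "mult unit a = a"
    and unit_right: "mult a unit = a"

text \<open>The bimodule structure \<open>a \<cdot> (u \<otimes> v) = (a u) \<otimes> v\<close> and \<open>(u \<otimes> v) \<cdot> b = u \<otimes> (v b)\<close>.\<close>

definition left_act ::
    "(('a \<Rightarrow>\<^sub>0 'k::{comm_ring,comm_monoid_mult}) \<Rightarrow> ('a \<Rightarrow>\<^sub>0 'k) \<Rightarrow> ('a \<Rightarrow>\<^sub>0 'k))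
      \<Rightarrow> ('a \<Rightarrow>\<^sub>0 'k) \<Rightarrow> ('a \<times> 'a \<Rightarrow>\<^sub>0 'k) \<Rightarrow> ('a \<times> 'a \<Rightarrow>\<^sub>0 'k)"
  where "left_act mult a = tensor_map (\<lambda>u. mult a u) id"

definition right_act ::
    "(('a \<Rightarrow>\<^sub>0 'k::{comm_ring,comm_monoid_mult}) \<Rightarrow> ('a \<Rightarrow>\<^sub>0 'k) \<Rightarrow> ('a \<Rightarrow>\<^sub>0 'k))
      \<Rightarrow> ('a \<times> 'a \<Rightarrow>\<^sub>0 'k) \<Rightarrow> ('a \<Rightarrow>\<^sub>0 'k) \<Rightarrow> ('a \<times> 'a \<Rightarrow>\<^sub>0 'k)"
  where "right_act mult t b = tensor_map id (\<lambda>v. mult v b) t"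

locale unitary_inf_bialgebra = unitary_algebra mult unit
  for mult :: "('a \<Rightarrow>\<^sub>0 'k::{comm_ring,comm_monoid_mult}) \<Rightarrow> ('a \<Rightarrow>\<^sub>0 'k) \<Rightarrow> ('a \<Rightarrow>\<^sub>0 'k)"
    and unit :: "'a \<Rightarrow>\<^sub>0 'k" +
  fixes \<Delta> :: "('a \<Rightarrow>\<^sub>0 'k) \<Rightarrow> ('a \<times> 'a \<Rightarrow>\<^sub>0 'k)"
  assumes linear_coproduct: "klinear \<Delta>"
    and coassoc: "assoc_r (tensor_map \<Delta> id (\<Delta> a)) = tensor_map id \<Delta> (\<Delta> a)"
    and coproduct_mult: "\<Delta> (mult a b) = left_act mult a (\<Delta> b) + right_act mult (\<Delta> a) b"

definition unitary_algebra_iso ::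
    "(('a \<Rightarrow>\<^sub>0 'k::{comm_ring,comm_monoid_mult}) \<Rightarrow> ('a \<Rightarrow>\<^sub>0 'k) \<Rightarrow> ('a \<Rightarrow>\<^sub>0 'k)) \<Rightarrow> ('a \<Rightarrow>\<^sub>0 'k)
      \<Rightarrow> (('b \<Rightarrow>\<^sub>0 'k) \<Rightarrow> ('b \<Rightarrow>\<^sub>0 'k) \<Rightarrow> ('b \<Rightarrow>\<^sub>0 'k)) \<Rightarrow> ('b \<Rightarrow>\<^sub>0 'k)
      \<Rightarrow> (('a \<Rightarrow>\<^sub>0 'k) \<Rightarrow> ('b \<Rightarrow>\<^sub>0 'k)) \<Rightarrow> bool"
  where "unitary_algebra_iso mult unit mult' unit' \<Theta> \<longleftrightarrow>
    unitary_algebra mult unit \<and> unitary_algebra mult' unit' \<and>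
    klinear \<Theta> \<and> bij \<Theta> \<and> \<Theta> unit = unit' \<and> (\<forall>a b. \<Theta> (mult a b) = mult' (\<Theta> a) (\<Theta> b))"

definition unitary_inf_bialgebra_iso ::
    "(('a \<Rightarrow>\<^sub>0 'k::{comm_ring,comm_monoid_mult}) \<Rightarrow> ('a \<Rightarrow>\<^sub>0 'k) \<Rightarrow> ('a \<Rightarrow>\<^sub>0 'k)) \<Rightarrow> ('a \<Rightarrow>\<^sub>0 'k)
      \<Rightarrow> (('a \<Rightarrow>\<^sub>0 'k) \<Rightarrow> ('a \<times> 'a \<Rightarrow>\<^sub>0 'k))
      \<Rightarrow> (('b \<Rightarrow>\<^sub>0 'k) \<Rightarrow> ('b \<Rightarrow>\<^sub>0 'k) \<Rightarrow> ('b \<Rightarrow>\<^sub>0 'k)) \<Rightarrow> ('b \<Rightarrow>\<^sub>0 'k)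
      \<Rightarrow> (('b \<Rightarrow>\<^sub>0 'k) \<Rightarrow> ('b \<times> 'b \<Rightarrow>\<^sub>0 'k))
      \<Rightarrow> (('a \<Rightarrow>\<^sub>0 'k) \<Rightarrow> ('b \<Rightarrow>\<^sub>0 'k)) \<Rightarrow> bool"
  where "unitary_inf_bialgebra_iso mult unit \<Delta> mult' unit' \<Delta>' \<Theta> \<longleftrightarrow>
    unitary_inf_bialgebra mult unit \<Delta> \<and> unitary_inf_bialgebra mult' unit' \<Delta>' \<and>
    unitary_algebra_iso mult unit mult' unit' \<Theta> \<and>
    (\<forall>a. tensor_map \<Theta> \<Theta> (\<Delta> a) = \<Delta>' (\<Theta> a))"


section \<open>Planar binary trees\<close>

datatype bintree = Triv | Vee bintree bintree

text \<open>Grafting as a linear map on the tensor square.\<close>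

definition graft :: "(bintree \<times> bintree \<Rightarrow>\<^sub>0 'k::{comm_ring,comm_monoid_mult}) \<Rightarrow> (bintree \<Rightarrow>\<^sub>0 'k)"
  where "graft = lin_ext (\<lambda>(l, r). basis (Vee l r))"

primrec under_tree :: "bintree \<Rightarrow> bintree \<Rightarrow> bintree" where
  "under_tree Triv T = T"
| "under_tree (Vee Sl Sr) T = Vee Sl (under_tree Sr T)"

definition under_prod ::
    "(bintree \<Rightarrow>\<^sub>0 'k::{comm_ring,comm_monoid_mult}) \<Rightarrow> (bintree \<Rightarrow>\<^sub>0 'k) \<Rightarrow> (bintree \<Rightarrow>\<^sub>0 'k)"
  where "under_prod = bilin_ext (\<lambda>S T. basis (under_tree S T))"

primrec coproduct_LR_tree ::
    "bintree \<Rightarrow> (bintree \<times> bintree \<Rightarrow>\<^sub>0 'k::{comm_ring,comm_monoid_mult})" where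
  "coproduct_LR_tree Triv = 0"
| "coproduct_LR_tree (Vee l r) = basis l \<otimes> basis r
    + tensor_map id graft (assoc_r (coproduct_LR_tree l \<otimes> basis r))
    + tensor_map graft id (assoc_l (basis l \<otimes> coproduct_LR_tree r))"

definition coproduct_LR ::
    "(bintree \<Rightarrow>\<^sub>0 'k::{comm_ring,comm_monoid_mult}) \<Rightarrow> (bintree \<times> bintree \<Rightarrow>\<^sub>0 'k)"
  where "coproduct_LR = lin_ext coproduct_LR_tree"


section \<open>Planar rooted forests\<close>

datatype ptree = Bplus "ptree list"

type_synonym forest = "ptree list"

definition conc ::
    "(forest \<Rightarrow>\<^sub>0 'k::{comm_ring,comm_monoid_mult}) \<Rightarrow> (forest \<Rightarrow>\<^sub>0 'k) \<Rightarrow> (forest \<Rightarrow>\<^sub>0 'k)"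
  where "conc = bilin_ext (\<lambda>F G. basis (F @ G))"

definition B_plus :: "(forest \<Rightarrow>\<^sub>0 'k::{comm_ring,comm_monoid_mult}) \<Rightarrow> (forest \<Rightarrow>\<^sub>0 'k)"
  where "B_plus = lin_ext (\<lambda>F. basis [Bplus F])"

text \<open>
  The coproduct of a nonempty forest \<open>B\<^sup>+(F) G\<close> is obtained from the product rule and the formula
  for \<open>B\<^sup>+(F)\<close>; the lemma \<open>is_RT_coproduct_iff\<close> below shows that this is the unique linear map with
  the three defining properties of the rooted-forest coproduct.
\<close>

fun coproduct_RT_forest ::
    "forest \<Rightarrow> (forest \<times> forest \<Rightarrow>\<^sub>0 'k::{comm_ring,comm_monoid_mult})" where
  "coproduct_RT_forest [] = 0"
| "coproduct_RT_forest (Bplus F # G) =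
    left_act conc (basis [Bplus F]) (coproduct_RT_forest G)
    + right_act conc (basis F \<otimes> basis [] + tensor_map id B_plus (coproduct_RT_forest F)) (basis G)"

definition coproduct_RT ::
    "(forest \<Rightarrow>\<^sub>0 'k::{comm_ring,comm_monoid_mult}) \<Rightarrow> (forest \<times> forest \<Rightarrow>\<^sub>0 'k)"
  where "coproduct_RT = lin_ext coproduct_RT_forest"

definition is_RT_coproduct ::
    "((forest \<Rightarrow>\<^sub>0 'k::{comm_ring,comm_monoid_mult}) \<Rightarrow> (forest \<times> forest \<Rightarrow>\<^sub>0 'k)) \<Rightarrow> bool"
  where "is_RT_coproduct \<Delta> \<longleftrightarrow> klinear \<Delta> \<and> \<Delta> (basis []) = 0 \<and>
    (\<forall>F. \<Delta> (basis [Bplus F]) = basis F \<otimes> basis [] + tensor_map id B_plus (\<Delta> (basis F))) \<and>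
    (\<forall>p q. \<Delta> (conc p q) = left_act conc p (\<Delta> q) + right_act conc (\<Delta> p) q)"

definition is_Theta ::
    "((forest \<Rightarrow>\<^sub>0 'k::{comm_ring,comm_monoid_mult}) \<Rightarrow> (bintree \<Rightarrow>\<^sub>0 'k)) \<Rightarrow> bool"
  where "is_Theta \<Theta> \<longleftrightarrow>
    unitary_algebra_iso conc (basis []) under_prod (basis Triv) \<Theta> \<and>
    (\<forall>F. \<Theta> (basis [Bplus F]) = graft (\<Theta> (basis F) \<otimes> basis Triv))"


section \<open>The rooted-forest coproduct is determined by its defining properties\<close>

lemma lookup_scale [simp]: "Poly_Mapping.lookup (scale c p) x = c * Poly_Mapping.lookup p x"
  unfolding scale_def by transfer (simp add: when_def)

lemma scale_simps [simp]:
  "scale c (p + q) = scale c p + scale c q"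
  "scale c 0 = 0"
  "scale 0 p = 0"
  "scale 1 p = p"
  "scale (c + d) p = scale c p + scale d p"
  "scale c (scale d p) = scale (c * d) p"
  by (rule poly_mapping_eqI; simp add: lookup_add algebra_simps)+

lemma scale_sum: "scale c (\<Sum>x\<in>A. f x) = (\<Sum>x\<in>A. scale c (f x))"
  by (induction A rule: infinite_finite_induct) simp_all

lemma lin_ext_superset:
  assumes "finite A" "Poly_Mapping.keys p \<subseteq> A"
  shows "lin_ext f p = (\<Sum>a\<in>A. scale (Poly_Mapping.lookup p a) (f a))"
  unfolding lin_ext_def
  by (rule sum.mono_neutral_left) (use assms in \<open>auto simp: in_keys_iff\<close>)

lemma klinear_lin_ext: "klinear (lin_ext f)"
proof -
  have "lin_ext f (p + q) = lin_ext f p + lin_ext f q" for p q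
  proof -
    let ?A = "Poly_Mapping.keys p \<union> Poly_Mapping.keys q"
    have "Poly_Mapping.keys (p + q) \<subseteq> ?A" by (rule Poly_Mapping.keys_add)
    then show ?thesis
      by (simp add: lin_ext_superset[of ?A] lookup_add sum.distrib)
  qed
  moreover have "lin_ext f (scale c p) = scale c (lin_ext f p)" for c p
  proof -
    have "Poly_Mapping.keys (scale c p) \<subseteq> Poly_Mapping.keys p"
      by (auto simp: in_keys_iff)
    then show ?thesis
      by (simp add: lin_ext_superset[of "Poly_Mapping.keys p"] scale_sum)
  qed
  ultimately show ?thesis by (simp add: klinear_def)
qed

lemma lin_ext_basis [simp]: "lin_ext f (basis a) = f a"
  by (subst lin_ext_superset[of "{a}"]) (auto simp: basis_def in_keys_iff lookup_single when_def
      split: if_splits)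

lemma lin_ext_id: "lin_ext basis p = p"
proof (rule poly_mapping_eqI)
  fix x
  have "Poly_Mapping.lookup (lin_ext basis p) x =
    (\<Sum>a\<in>Poly_Mapping.keys p. Poly_Mapping.lookup p a * Poly_Mapping.lookup (basis a) x)"
    by (simp add: lin_ext_def lookup_sum)
  also have "\<dots> = (\<Sum>a\<in>Poly_Mapping.keys p. if a = x then Poly_Mapping.lookup p a else 0)"
    by (rule sum.cong) (auto simp: basis_def lookup_single when_def)
  also have "\<dots> = Poly_Mapping.lookup p x"
    by (simp add: in_keys_iff)
  finally show "Poly_Mapping.lookup (lin_ext basis p) x = Poly_Mapping.lookup p x" .
qed

lemma klinearD:
  assumes "klinear f"
  shows "f (p + q) = f p + f q" "f (scale c p) = scale c (f p)" "f 0 = 0"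
proof -
  show "f (p + q) = f p + f q" "f (scale c p) = scale c (f p)"
    using assms by (simp_all add: klinear_def)
  have "f (scale 0 0) = scale 0 (f 0)"
    using assms unfolding klinear_def by blast
  then show "f 0 = 0" by simp
qed

lemma klinear_eqI:
  assumes f: "klinear f" and g: "klinear g" and eq: "\<And>a. f (basis a) = g (basis a)"
  shows "f p = g p"
proof -
  have *: "h (lin_ext basis p) = lin_ext (\<lambda>a. h (basis a)) p" if "klinear h" for h :: "('a \<Rightarrow>\<^sub>0 'b) \<Rightarrow> ('c \<Rightarrow>\<^sub>0 'b)"
  proof -
    have "h (\<Sum>a\<in>A. scale (c a) (basis a)) = (\<Sum>a\<in>A. scale (c a) (h (basis a)))" for A c
      by (induction A rule: infinite_finite_induct) (simp_all add: klinearD[OF that])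
    then show ?thesis by (simp add: lin_ext_def)
  qed
  show ?thesis
    using *[OF f] *[OF g] by (simp add: lin_ext_id eq)
qed

lemma klinear_add: "klinear f \<Longrightarrow> klinear g \<Longrightarrow> klinear (\<lambda>p. f p + g p)"
  by (simp add: klinear_def add_ac)

lemma klinear_comp: "klinear f \<Longrightarrow> klinear g \<Longrightarrow> klinear (\<lambda>p. f (g p))"
  by (simp add: klinear_def)

lemma klinear_id: "klinear id"
  by (simp add: klinear_def)

lemma lin_ext_fun_linear:
  assumes "\<And>a. klinear (\<lambda>q. f q a)"
  shows "klinear (\<lambda>q. lin_ext (f q) p)"
  unfolding klinear_def lin_ext_def
  by (simp add: klinearD[OF assms] sum.distrib scale_sum mult.commute)

lemma kbilinear_bilin_ext: "kbilinear (bilin_ext f)"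
  unfolding kbilinear_def bilin_ext_def
  by (auto intro!: lin_ext_fun_linear klinear_lin_ext)

lemma bilin_ext_basis [simp]: "bilin_ext f (basis a) (basis b) = f a b"
  by (simp add: bilin_ext_def)

lemma klinear_bilin_ext:
  "klinear (bilin_ext f p)" "klinear (\<lambda>p. bilin_ext f p q)"
  using kbilinear_bilin_ext unfolding kbilinear_def by blast+

lemmas klinear_tensor = klinear_bilin_ext[of "\<lambda>a b. basis (a, b)", folded tensor_def]
lemmas klinear_conc = klinear_bilin_ext[of "\<lambda>F G. basis ((F::forest) @ G)", folded conc_def]

lemma tensor_basis [simp]: "basis a \<otimes> basis b = basis (a, b)"
  by (simp add: tensor_def)

lemma conc_basis [simp]: "conc (basis F) (basis G) = basis (F @ G)"
  by (simp add: conc_def)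

lemma klinear_tensor_map: "klinear (tensor_map f g)"
  unfolding tensor_map_def by (rule klinear_lin_ext)

lemma klinear_left_act: "klinear (left_act conc p)" "klinear (\<lambda>p. left_act conc p t)"
proof -
  show "klinear (left_act conc p)"
    unfolding left_act_def by (rule klinear_tensor_map)
  have "klinear (\<lambda>p. case ab of (a, b) \<Rightarrow> conc p (basis a) \<otimes> id (basis b))" for ab :: "forest \<times> forest"
    by (cases ab) (simp add: klinear_comp[OF klinear_tensor(2) klinear_conc(2)])
  then show "klinear (\<lambda>p. left_act conc p t)"
    unfolding left_act_def tensor_map_def by (rule lin_ext_fun_linear)
qed

lemma klinear_right_act: "klinear (right_act conc t)" "klinear (\<lambda>t. right_act conc t p)"
proof -
  show "klinear (\<lambda>t. right_act conc t p)"
    unfolding right_act_def by (rule klinear_tensor_map)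
  have "klinear (\<lambda>p. case ab of (a, b) \<Rightarrow> id (basis a) \<otimes> conc (basis b) p)" for ab :: "forest \<times> forest"
    by (cases ab) (simp add: klinear_comp[OF klinear_tensor(1) klinear_conc(1)])
  then show "klinear (right_act conc t)"
    unfolding right_act_def tensor_map_def by (rule lin_ext_fun_linear)
qed

lemma act_basis [simp]:
  "left_act conc (basis F) (basis (G, H)) = basis (F @ G, H)"
  "right_act conc (basis (G, H)) (basis F) = basis (G, H @ F)"
  by (simp_all add: left_act_def right_act_def tensor_map_def)

lemma left_act_append:
  "left_act conc (basis (F @ G)) t = left_act conc (basis F) (left_act conc (basis G) t)"
  by (rule klinear_eqI[where f = "left_act conc (basis (F @ G))"])
    (auto intro: klinear_left_act klinear_comp)

lemma right_act_append:
  "right_act conc t (basis (F @ G)) = right_act conc (right_act conc t (basis F)) (basis G)"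
  by (rule klinear_eqI[where f = "\<lambda>t. right_act conc t (basis (F @ G))"])
    (auto intro: klinear_right_act(2) klinear_comp[OF klinear_right_act(2)[of "basis G"] klinear_right_act(2)])

lemma left_right_act:
  "left_act conc (basis F) (right_act conc t (basis G)) = right_act conc (left_act conc (basis F) t) (basis G)"
  by (rule klinear_eqI[where f = "\<lambda>t. left_act conc (basis F) (right_act conc t (basis G))"])
    (auto intro: klinear_comp[OF klinear_right_act(2) klinear_left_act(1)]
      klinear_comp[OF klinear_left_act(1) klinear_right_act(2)])

lemma act_unit [simp]: "left_act conc (basis []) t = t" "right_act conc t (basis []) = t"
proof -
  have "left_act conc (basis []) t = id t"
    by (rule klinear_eqI[OF klinear_left_act(1) klinear_id]) auto
  then show "left_act conc (basis []) t = t" by simp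
  have "right_act conc t (basis []) = id t"
    by (rule klinear_eqI[OF klinear_right_act(2) klinear_id]) auto
  then show "right_act conc t (basis []) = t" by simp
qed

lemma coproduct_RT_append:
  "coproduct_RT_forest (F @ G) = left_act conc (basis F) (coproduct_RT_forest G)
    + right_act conc (coproduct_RT_forest F) (basis G)"
proof (induction F)
  case Nil
  then show ?case by (simp add: klinearD(3)[OF klinear_right_act(2)])
next
  case (Cons t F)
  obtain H where t: "t = Bplus H" by (cases t)
  have "left_act conc (basis (Bplus H # F)) u
      = left_act conc (basis [Bplus H]) (left_act conc (basis F) u)" for u :: "forest \<times> forest \<Rightarrow>\<^sub>0 'a"
    using left_act_append[of "[Bplus H]" F u] by simp
  then show ?case
    using Cons
    by (simp add: t klinearD(1)[OF klinear_left_act(1)] klinearD(1)[OF klinear_right_act(2)]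
        left_right_act right_act_append add_ac)
qed

lemma is_RT_coproduct_iff: "is_RT_coproduct \<Delta> \<longleftrightarrow> \<Delta> = coproduct_RT"
proof
  assume "\<Delta> = coproduct_RT"
  moreover have "coproduct_RT (conc p q) = left_act conc p (coproduct_RT q) + right_act conc (coproduct_RT p) q"
    for p q :: "forest \<Rightarrow>\<^sub>0 'a"
  proof (rule klinear_eqI[where p = p])
    have lin: "klinear (coproduct_RT :: (forest \<Rightarrow>\<^sub>0 'a) \<Rightarrow> _)" unfolding coproduct_RT_def by (rule klinear_lin_ext)
    show "klinear (\<lambda>p :: forest \<Rightarrow>\<^sub>0 'a. coproduct_RT (conc p q))"
      by (rule klinear_comp[OF lin klinear_conc(2)])
    show "klinear (\<lambda>p :: forest \<Rightarrow>\<^sub>0 'a. left_act conc p (coproduct_RT q) + right_act conc (coproduct_RT p) q)"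
      by (intro klinear_add klinear_left_act klinear_comp[OF klinear_right_act(2) lin])
    fix F
    show "coproduct_RT (conc (basis F) q)
      = left_act conc (basis F) (coproduct_RT q) + right_act conc (coproduct_RT (basis F)) q"
    proof (rule klinear_eqI[where p = q])
      show "klinear (\<lambda>q :: forest \<Rightarrow>\<^sub>0 'a. coproduct_RT (conc (basis F) q))"
        by (rule klinear_comp[OF lin klinear_conc(1)])
      show "klinear (\<lambda>q :: forest \<Rightarrow>\<^sub>0 'a. left_act conc (basis F) (coproduct_RT q) + right_act conc (coproduct_RT (basis F)) q)"
        by (intro klinear_add klinear_right_act klinear_comp[OF klinear_left_act(1) lin])
    qed (simp add: coproduct_RT_def coproduct_RT_append)
  qed
  ultimately show "is_RT_coproduct \<Delta>"
    by (simp add: is_RT_coproduct_def coproduct_RT_def klinear_lin_ext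
        klinearD(3)[OF klinear_left_act(1)])
next
  assume D: "is_RT_coproduct \<Delta>"
  have eq: "\<Delta> (basis F) = coproduct_RT_forest F" for F
  proof (induction F rule: coproduct_RT_forest.induct)
    case 1
    then show ?case using D by (simp add: is_RT_coproduct_def)
  next
    case (2 F G)
    have "\<Delta> (conc (basis [Bplus F]) (basis G))
      = left_act conc (basis [Bplus F]) (\<Delta> (basis G)) + right_act conc (\<Delta> (basis [Bplus F])) (basis G)"
      using D unfolding is_RT_coproduct_def by blast
    moreover have "\<Delta> (basis [Bplus F]) = basis F \<otimes> basis [] + tensor_map id B_plus (\<Delta> (basis F))"
      using D unfolding is_RT_coproduct_def by blast
    ultimately show ?case using 2 by simp
  qed
  have "\<Delta> p = coproduct_RT p" for p
    by (rule klinear_eqI[where f = \<Delta> and g = coproduct_RT and p = p])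
      (use D in \<open>simp_all add: eq coproduct_RT_def klinear_lin_ext is_RT_coproduct_def\<close>)
  then show "\<Delta> = coproduct_RT" by (rule ext)
qed

end

theory Submission
  imports Defs
begin

text \<open>
  A morphism of unitary algebras with \<open>\<Theta>(B\<^sup>+(F)) = \<Theta>(F) \<or> |\<close> must send the basis forest
  \<open>B\<^sup>+(F) G\<close> to \<open>(\<Theta>(F) \<or> |)\<close> under \<open>\<Theta>(G)\<close>, which is \<open>\<Theta>(F) \<or> \<Theta>(G)\<close>. So \<open>\<Theta>\<close> is forced to be the
  linear extension of the classical bijection \<open>bintree_of\<close> between planar forests and planar binary
  trees, and conversely this extension is an algebra isomorphism because the bijection turns
  concatenation into the under product.

  Both coproducts are sums of pure tensors of basis elements. For a binary tree with internal
  vertices listed in infix order, each vertex \<open>v\<close> contributes the part before \<open>v\<close> tensor the part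
  after \<open>v\<close>; the list \<open>cuts\<close> records these pairs in that order. Since infix order reads \<open>S\<close> before
  \<open>T\<close> in the under product of \<open>S\<close> and \<open>T\<close>, the product rule for the coproduct becomes an equation
  between lists (\<open>cuts_under_tree\<close>). Coassociativity holds because cutting twice amounts to choosing
  two vertices \<open>v < w\<close>, whichever of them is cut first; it is proved by induction as an identity of
  iterated sums (\<open>cuts_coassoc\<close>).

  The recursion of the rooted-forest coproduct on \<open>B\<^sup>+(F) G\<close> produces the term \<open>F \<otimes> G\<close>, the cuts of
  \<open>F\<close> and the cuts of \<open>G\<close>, exactly as the recursion on \<open>l \<or> r\<close> does. Hence the cuts of a forest
  are the cuts of its binary tree read through the bijection
  (\<open>coproduct_RT_forest_eq_cuts\<close>), which yields at once the coassociativity of the forest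
  coproduct and its compatibility with \<open>\<Theta>\<close>.
\<close>

section \<open>Linear and bilinear extensions of maps between bases\<close>

lemma klinear_sum_list:
  assumes "klinear f"
  shows "f (\<Sum>x\<leftarrow>xs. g x) = (\<Sum>x\<leftarrow>xs. f (g x))"
  by (induction xs) (simp_all add: klinearD[OF assms])

lemma tensor_map_basis [simp]: "tensor_map f g (basis p) = f (basis (fst p)) \<otimes> g (basis (snd p))"
  by (simp add: tensor_map_def split_def)

lemma act_basis_basis [simp]:
  "left_act M a (basis p) = M a (basis (fst p)) \<otimes> basis (snd p)"
  "right_act M (basis p) b = basis (fst p) \<otimes> M (basis (snd p)) b"
  by (simp_all add: left_act_def right_act_def)

lemma klinear_assoc: "klinear assoc_r" "klinear assoc_l"
  by (simp_all add: assoc_r_def assoc_l_def klinear_lin_ext)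

lemma assoc_basis [simp]:
  "assoc_r (basis p) = basis (fst (fst p), snd (fst p), snd p)"
  "assoc_l (basis q) = basis ((fst q, fst (snd q)), snd (snd q))"
  by (simp_all add: assoc_r_def assoc_l_def split_def)

text \<open>
  The algebra of a monoid: by multilinearity the axioms need only be checked on basis elements.
\<close>

lemma unitary_algebra_bilin_ext:
  assumes assoc: "\<And>a b c. m (m a b) c = m a (m b c)"
    and unit: "\<And>a. m e a = a" "\<And>a. m a e = a"
  shows "unitary_algebra (bilin_ext (\<lambda>a b. basis (m a b) :: 'a \<Rightarrow>\<^sub>0 'k::{comm_ring,comm_monoid_mult}))
    (basis e)"
    (is "unitary_algebra ?M _")
proof
  show "kbilinear ?M" by (rule kbilinear_bilin_ext)
  note lin = klinear_bilin_ext[of "\<lambda>a b. basis (m a b) :: 'a \<Rightarrow>\<^sub>0 'k"]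
  show "?M (?M p q) r = ?M p (?M q r)" for p q r
  proof (rule klinear_eqI[where p = p])
    show "klinear (\<lambda>p. ?M (?M p q) r)" by (rule klinear_comp[OF lin(2) lin(2)])
    show "klinear (\<lambda>p. ?M p (?M q r))" by (rule lin(2))
    show "?M (?M (basis a) q) r = ?M (basis a) (?M q r)" for a
    proof (rule klinear_eqI[where p = q])
      show "klinear (\<lambda>q. ?M (?M (basis a) q) r)" by (rule klinear_comp[OF lin(2) lin(1)])
      show "klinear (\<lambda>q. ?M (basis a) (?M q r))" by (rule klinear_comp[OF lin(1) lin(2)])
      show "?M (?M (basis a) (basis b)) r = ?M (basis a) (?M (basis b) r)" for b
        by (rule klinear_eqI[where p = r])
          (simp_all add: lin klinear_comp[OF lin(1) lin(1)] assoc)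
    qed
  qed
  show "?M (basis e) p = p" for p
    using klinear_eqI[OF lin(1) klinear_id, of "basis e" p] by (simp add: unit)
  show "?M p (basis e) = p" for p
    using klinear_eqI[OF lin(2) klinear_id, of "basis e" p] by (simp add: unit)
qed

text \<open>Functoriality of the monoid algebra in the monoid.\<close>

lemma lin_ext_bilin_ext:
  assumes "\<And>a b. \<phi> (m a b) = m' (\<phi> a) (\<phi> b)"
  shows "lin_ext (\<lambda>a. basis (\<phi> a)) (bilin_ext (\<lambda>a b. basis (m a b)) p q)
    = bilin_ext (\<lambda>a b. basis (m' a b)) (lin_ext (\<lambda>a. basis (\<phi> a)) p)
        (lin_ext (\<lambda>a. basis (\<phi> a) :: 'b \<Rightarrow>\<^sub>0 'k::{comm_ring,comm_monoid_mult}) q)"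
    (is "?T (?M p q) = ?M' (?T p) (?T q)")
proof (rule klinear_eqI[where p = p])
  note lin = klinear_bilin_ext klinear_lin_ext
  show "klinear (\<lambda>p. ?T (?M p q))" by (rule klinear_comp[OF lin(3) lin(2)])
  show "klinear (\<lambda>p. ?M' (?T p) (?T q))" by (rule klinear_comp[OF lin(2) lin(3)])
  show "?T (?M (basis a) q) = ?M' (?T (basis a)) (?T q)" for a
    by (rule klinear_eqI[where p = q])
      (simp_all add: assms klinear_comp[OF lin(3) lin(1)] klinear_comp[OF lin(1) lin(3)])
qed

lemma bij_lin_ext_basis:
  fixes \<phi> :: "'a \<Rightarrow> 'b"
  assumes "bij \<phi>"
  shows "bij (lin_ext (\<lambda>a. basis (\<phi> a) :: 'b \<Rightarrow>\<^sub>0 'k::{comm_ring,comm_monoid_mult}))" (is "bij ?f")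
proof (rule o_bij)
  let ?g = "lin_ext (\<lambda>b. basis (inv \<phi> b) :: 'a \<Rightarrow>\<^sub>0 'k)"
  have "?g (?f p) = id p" for p
    by (rule klinear_eqI[where p = p])
      (simp_all add: klinear_comp[OF klinear_lin_ext klinear_lin_ext] klinear_id[unfolded id_def]
        inv_f_f[OF bij_is_inj[OF assms]])
  then show "?g \<circ> ?f = id" by auto
  have "?f (?g p) = id p" for p
    by (rule klinear_eqI[where p = p])
      (simp_all add: klinear_comp[OF klinear_lin_ext klinear_lin_ext] klinear_id[unfolded id_def]
        surj_f_inv_f[OF bij_is_surj[OF assms]])
  then show "?f \<circ> ?g = id" by auto
qed


section \<open>Coproducts given by lists of cuts\<close>

text \<open>
  Listing the pairs in a fixed order lets identities between coproducts be checked as identities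
  between lists, before any linear algebra.
\<close>

definition cut_coproduct ::
    "('a \<Rightarrow> ('a \<times> 'a) list) \<Rightarrow> ('a \<Rightarrow>\<^sub>0 'k::{comm_ring,comm_monoid_mult}) \<Rightarrow> ('a \<times> 'a \<Rightarrow>\<^sub>0 'k)"
  where "cut_coproduct c = lin_ext (\<lambda>x. \<Sum>(a, b)\<leftarrow>c x. basis (a, b))"

lemma klinear_cut_coproduct: "klinear (cut_coproduct c)"
  unfolding cut_coproduct_def by (rule klinear_lin_ext)

lemma cut_coproduct_basis: "cut_coproduct c (basis x) = (\<Sum>p\<leftarrow>c x. basis p)"
  by (simp add: cut_coproduct_def)

text \<open>
  On a basis element, the two sides of coassociativity are sums of pure tensors over twofold cuts,
  where the second cut is made in the left or in the right part of the first one. The hypothesis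
  says that both families of triples agree up to order, phrased through sums of an arbitrary \<open>g\<close>.
\<close>

lemma coassoc_cut_coproduct:
  fixes p :: "'a \<Rightarrow>\<^sub>0 'k::{comm_ring,comm_monoid_mult}"
  assumes "\<And>x (g :: 'a \<Rightarrow> 'a \<Rightarrow> 'a \<Rightarrow> ('a \<times> 'a \<times> 'a \<Rightarrow>\<^sub>0 'k)).
    (\<Sum>(a, b)\<leftarrow>c x. \<Sum>(u, v)\<leftarrow>c a. g u v b) = (\<Sum>(a, b)\<leftarrow>c x. \<Sum>(u, v)\<leftarrow>c b. g a u v)"
  shows "assoc_r (tensor_map (cut_coproduct c) id (cut_coproduct c p))
    = tensor_map id (cut_coproduct c) (cut_coproduct c p)"
proof (rule klinear_eqI[where p = p])
  note lin = klinear_assoc klinear_tensor_map klinear_cut_coproduct klinear_tensor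
  show "klinear (\<lambda>p::'a \<Rightarrow>\<^sub>0 'k. assoc_r (tensor_map (cut_coproduct c) id (cut_coproduct c p)))"
    by (rule klinear_comp[OF lin(1) klinear_comp[OF lin(3) lin(4)]])
  show "klinear (\<lambda>p::'a \<Rightarrow>\<^sub>0 'k. tensor_map id (cut_coproduct c) (cut_coproduct c p))"
    by (rule klinear_comp[OF lin(3) lin(4)])
  show "assoc_r (tensor_map (cut_coproduct c) id (cut_coproduct c (basis x)))
    = tensor_map id (cut_coproduct c) (cut_coproduct c (basis x :: 'a \<Rightarrow>\<^sub>0 'k))" for x
    using assms[of "\<lambda>u v w. basis (u, v, w)" x]
    by (simp add: cut_coproduct_basis split_def klinear_sum_list[OF lin(1)]
      klinear_sum_list[OF lin(3)] klinear_sum_list[OF lin(5)] klinear_sum_list[OF lin(6)])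
qed

text \<open>
  If a cut of a product is a cut of one of its factors, with the other factor absorbed by the
  adjacent part, then the coproduct is a derivation into the bimodule \<open>A \<otimes> A\<close>.
\<close>

lemma cut_coproduct_mult:
  fixes p q :: "'a \<Rightarrow>\<^sub>0 'k::{comm_ring,comm_monoid_mult}"
  assumes cuts: "\<And>x y. c (m x y) = map (\<lambda>(a, b). (a, m b y)) (c x) @ map (\<lambda>(a, b). (m x a, b)) (c y)"
  defines "M \<equiv> bilin_ext (\<lambda>a b. basis (m a b))"
  shows "cut_coproduct c (M p q)
    = left_act M p (cut_coproduct c q) + right_act M (cut_coproduct c p) q"
proof -
  note lin = klinear_bilin_ext[of "\<lambda>a b. basis (m a b) :: 'a \<Rightarrow>\<^sub>0 'k", folded M_def]
  have M: "M (basis a) (basis b) = basis (m a b)" for a b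
    by (simp add: M_def)
  have left: "klinear (left_act M x)" "klinear (\<lambda>x. left_act M x t)" for x t
    unfolding left_act_def tensor_map_def
    by (auto intro!: klinear_lin_ext lin_ext_fun_linear klinear_comp[OF klinear_tensor(2) lin(2)] 
        split: prod.split)
  have right: "klinear (right_act M t)" "klinear (\<lambda>t. right_act M t x)" for x t
    unfolding right_act_def tensor_map_def
    by (auto intro!: klinear_lin_ext lin_ext_fun_linear klinear_comp[OF klinear_tensor(1) lin(1)] 
        split: prod.split)
  note cut = klinear_cut_coproduct[of c]
  show ?thesis
  proof (rule klinear_eqI[where p = p])
    show "klinear (\<lambda>p. cut_coproduct c (M p q))" by (rule klinear_comp[OF cut lin(2)])
    show "klinear (\<lambda>p. left_act M p (cut_coproduct c q) + right_act M (cut_coproduct c p) q)"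
      by (intro klinear_add left klinear_comp[OF right(2) cut])
    show "cut_coproduct c (M (basis x) q)
      = left_act M (basis x) (cut_coproduct c q) + right_act M (cut_coproduct c (basis x)) q" for x
    proof (rule klinear_eqI[where p = q])
      show "klinear (\<lambda>q. cut_coproduct c (M (basis x) q))" by (rule klinear_comp[OF cut lin(1)])
      show "klinear (\<lambda>q. left_act M (basis x) (cut_coproduct c q)
          + right_act M (cut_coproduct c (basis x)) q)"
        by (intro klinear_add right klinear_comp[OF left(1) cut])
      show "cut_coproduct c (M (basis x) (basis y)) = left_act M (basis x) (cut_coproduct c (basis y))
          + right_act M (cut_coproduct c (basis x)) (basis y)" for y
        by (simp add: M cut_coproduct_basis cuts split_def o_def klinear_sum_list[OF left(1)]
            klinear_sum_list[OF right(2)] add.commute)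
    qed
  qed
qed


section \<open>Cutting a planar binary tree at an internal vertex\<close>

text \<open>
  The pair contributed by a vertex consists of what precedes and what follows it in infix order.
  The list follows this order, with the root between the left and the right branch; this makes
  the product rule below an equality of lists.
\<close>

primrec cuts :: "bintree \<Rightarrow> (bintree \<times> bintree) list" where
  "cuts Triv = []"
| "cuts (Vee l r) = map (\<lambda>(a, b). (a, Vee b r)) (cuts l) @ [(l, r)]
    @ map (\<lambda>(a, b). (Vee l a, b)) (cuts r)"

lemma graft_basis [simp]: "graft (basis (l, r)) = basis (Vee l r)"
  by (simp add: graft_def)

lemma coproduct_LR_tree_eq_cuts: "coproduct_LR_tree T = (\<Sum>p\<leftarrow>cuts T. basis p)"
proof (induction T)
  case (Vee l r)
  note lin = klinear_assoc klinear_tensor_map klinear_tensor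
  show ?case
    by (simp add: Vee split_def o_def klinear_sum_list[OF lin(1)] klinear_sum_list[OF lin(2)]
        klinear_sum_list[OF lin(3)] klinear_sum_list[OF lin(4)] klinear_sum_list[OF lin(5)] add_ac)
qed simp

lemma coproduct_LR_eq_cut_coproduct: "coproduct_LR = cut_coproduct cuts"
  by (simp add: coproduct_LR_def cut_coproduct_def coproduct_LR_tree_eq_cuts[abs_def])

lemma under_tree_Triv [simp]: "under_tree S Triv = S"
  by (induction S) simp_all

lemma under_tree_assoc: "under_tree (under_tree R S) T = under_tree R (under_tree S T)"
  by (induction R) simp_all

text \<open>
  \<open>T\<close> hangs on the rightmost branch of \<open>S\<close>, so a cut in \<open>S\<close> keeps \<open>T\<close> in its right part, and a cut
  in \<open>T\<close> keeps \<open>S\<close> in its left part.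
\<close>

lemma cuts_under_tree:
  "cuts (under_tree S T) = map (\<lambda>(a, b). (a, under_tree b T)) (cuts S)
    @ map (\<lambda>(a, b). (under_tree S a, b)) (cuts T)"
  by (induction S) (simp_all add: split_def o_def)

lemma sum_list_swap:
  fixes f :: "'a \<Rightarrow> 'b \<Rightarrow> 'c::comm_monoid_add"
  shows "(\<Sum>x\<leftarrow>xs. \<Sum>y\<leftarrow>ys. f x y) = (\<Sum>y\<leftarrow>ys. \<Sum>x\<leftarrow>xs. f x y)"
  by (induction xs) (simp_all add: sum_list_addf)

text \<open>
  Both sides run over the pairs of vertices \<open>v < w\<close> in infix order: on the left \<open>w\<close> is cut first, on
  the right \<open>v\<close>. In the induction, pairs inside one branch are covered by the hypotheses, pairs
  containing the root match directly, and pairs with \<open>v\<close> in the left and \<open>w\<close> in the right branch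
  require exchanging two sums.
\<close>

lemma cuts_coassoc:
  fixes g :: "bintree \<Rightarrow> bintree \<Rightarrow> bintree \<Rightarrow> 'c::comm_monoid_add"
  shows "(\<Sum>(a, b)\<leftarrow>cuts T. \<Sum>(u, v)\<leftarrow>cuts a. g u v b) = (\<Sum>(a, b)\<leftarrow>cuts T. \<Sum>(u, v)\<leftarrow>cuts b. g a u v)"
proof (induction T arbitrary: g)
  case (Vee l r)
  show ?case
    using Vee.IH(1)[of "\<lambda>u v w. g u v (Vee w r)"] Vee.IH(2)[of "\<lambda>u v w. g (Vee l u) v w"]
      sum_list_swap[of "\<lambda>p q. g (fst p) (Vee (snd p) (fst q)) (snd q)" "cuts r" "cuts l"]
    by (simp add: split_def o_def sum_list_addf add_ac)
qed simp


section \<open>Planar forests and planar binary trees\<close>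

text \<open>
  The bijection of first child and next sibling: the left branch encodes the children of the first
  root, the right branch the remaining trees of the forest.
\<close>

fun bintree_of :: "forest \<Rightarrow> bintree" where
  "bintree_of [] = Triv"
| "bintree_of (Bplus F # G) = Vee (bintree_of F) (bintree_of G)"

primrec forest_of :: "bintree \<Rightarrow> forest" where
  "forest_of Triv = []"
| "forest_of (Vee l r) = Bplus (forest_of l) # forest_of r"

lemma forest_of_bintree_of [simp]: "forest_of (bintree_of F) = F"
  by (induction F rule: bintree_of.induct) simp_all

lemma bintree_of_forest_of [simp]: "bintree_of (forest_of T) = T"
  by (induction T) simp_all

lemma bij_bintree_of: "bij bintree_of"
  by (rule o_bij[of forest_of]) auto

lemma bintree_of_append: "bintree_of (F @ G) = under_tree (bintree_of F) (bintree_of G)"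
  by (induction F rule: bintree_of.induct) simp_all

text \<open>
  Transporting the cuts along the bijection makes coassociativity and compatibility with the
  bijection immediate; what has to be proved is that they give the forest coproduct.
\<close>

definition forest_cuts :: "forest \<Rightarrow> (forest \<times> forest) list"
  where "forest_cuts F = map (map_prod forest_of forest_of) (cuts (bintree_of F))"

lemma B_plus_basis [simp]: "B_plus (basis F) = basis [Bplus F]"
  by (simp add: B_plus_def)

text \<open>
  On \<open>B\<^sup>+(F) G\<close>, the term \<open>F \<otimes> \<one>\<close> multiplied by \<open>G\<close> is the cut at the root of the binary tree, the
  terms \<open>(id \<otimes> B\<^sup>+)\<Delta>(F)\<close> multiplied by \<open>G\<close> are the cuts in its left branch, and \<open>B\<^sup>+(F) \<cdot> \<Delta>(G)\<close>
  gives the cuts in its right branch.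
\<close>

lemma coproduct_RT_forest_eq_cuts:
  "coproduct_RT_forest F = (\<Sum>p\<leftarrow>forest_cuts F. basis p)"
proof (induction F rule: coproduct_RT_forest.induct)
  case (2 F G)
  note lin = klinear_tensor_map klinear_left_act(1) klinear_right_act(2)
  show ?case
    by (simp add: 2 forest_cuts_def split_def o_def klinearD(1)[OF lin(3)] klinear_sum_list[OF lin(1)]
        klinear_sum_list[OF lin(2)] klinear_sum_list[OF lin(3)] add_ac)
qed (simp add: forest_cuts_def)

lemma coproduct_RT_eq_cut_coproduct: "coproduct_RT = cut_coproduct forest_cuts"
  by (simp add: coproduct_RT_def cut_coproduct_def coproduct_RT_forest_eq_cuts[abs_def])

lemma forest_cuts_coassoc:
  fixes g :: "forest \<Rightarrow> forest \<Rightarrow> forest \<Rightarrow> 'c::comm_monoid_add"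
  shows "(\<Sum>(a, b)\<leftarrow>forest_cuts F. \<Sum>(u, v)\<leftarrow>forest_cuts a. g u v b)
    = (\<Sum>(a, b)\<leftarrow>forest_cuts F. \<Sum>(u, v)\<leftarrow>forest_cuts b. g a u v)"
  using cuts_coassoc[of "\<lambda>u v w. g (forest_of u) (forest_of v) (forest_of w)" "bintree_of F"]
  by (simp add: forest_cuts_def split_def o_def)


section \<open>The two infinitesimal bialgebras and the isomorphism\<close>

lemma unitary_inf_bialgebra_LR: "unitary_inf_bialgebra under_prod (basis Triv) coproduct_LR"
proof -
  interpret unitary_algebra under_prod "basis Triv"
    unfolding under_prod_def by (rule unitary_algebra_bilin_ext) (simp_all add: under_tree_assoc)
  show ?thesis
    by unfold_locales
      (simp_all only: coproduct_LR_eq_cut_coproduct klinear_cut_coproduct under_prod_def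
        coassoc_cut_coproduct[OF cuts_coassoc] cut_coproduct_mult[OF cuts_under_tree])
qed

lemma unitary_inf_bialgebra_RT:
  "unitary_inf_bialgebra (conc :: (forest \<Rightarrow>\<^sub>0 'k::{comm_ring,comm_monoid_mult}) \<Rightarrow> _)
    (basis []) coproduct_RT"
proof -
  interpret unitary_algebra conc "basis []"
    unfolding conc_def by (rule unitary_algebra_bilin_ext) simp_all
  have "klinear (coproduct_RT :: (forest \<Rightarrow>\<^sub>0 'k) \<Rightarrow> _)"
    and "\<And>p q :: forest \<Rightarrow>\<^sub>0 'k. coproduct_RT (conc p q)
      = left_act conc p (coproduct_RT q) + right_act conc (coproduct_RT p) q"
    using is_RT_coproduct_iff[of "coproduct_RT :: (forest \<Rightarrow>\<^sub>0 'k) \<Rightarrow> _"]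
    by (simp_all add: is_RT_coproduct_def)
  moreover have "assoc_r (tensor_map coproduct_RT id (coproduct_RT p))
      = tensor_map id coproduct_RT (coproduct_RT p)" for p :: "forest \<Rightarrow>\<^sub>0 'k"
    unfolding coproduct_RT_eq_cut_coproduct
    by (rule coassoc_cut_coproduct[OF forest_cuts_coassoc])
  ultimately show ?thesis
    by unfold_locales
qed

definition bintree_relabel :: "(forest \<Rightarrow>\<^sub>0 'k::{comm_ring,comm_monoid_mult}) \<Rightarrow> (bintree \<Rightarrow>\<^sub>0 'k)"
  where "bintree_relabel = lin_ext (\<lambda>F. basis (bintree_of F))"

lemma bintree_relabel_basis [simp]: "bintree_relabel (basis F) = basis (bintree_of F)"
  by (simp add: bintree_relabel_def)

lemma klinear_bintree_relabel: "klinear bintree_relabel"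
  unfolding bintree_relabel_def by (rule klinear_lin_ext)

lemma is_Theta_bintree_relabel:
  "is_Theta (bintree_relabel :: (forest \<Rightarrow>\<^sub>0 'k::{comm_ring,comm_monoid_mult}) \<Rightarrow> _)"
proof -
  have "bintree_relabel (conc a b) = under_prod (bintree_relabel a) (bintree_relabel b)"
    for a b :: "forest \<Rightarrow>\<^sub>0 'k"
    unfolding bintree_relabel_def conc_def under_prod_def
    by (rule lin_ext_bilin_ext) (rule bintree_of_append)
  moreover have "bij (bintree_relabel :: (forest \<Rightarrow>\<^sub>0 'k) \<Rightarrow> _)"
    unfolding bintree_relabel_def by (rule bij_lin_ext_basis[OF bij_bintree_of])
  ultimately show ?thesis
    using unitary_inf_bialgebra_LR unitary_inf_bialgebra_RT
    by (auto simp: is_Theta_def unitary_algebra_iso_def klinear_bintree_relabel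
        unitary_inf_bialgebra_def)
qed

text \<open>
  A basis forest \<open>B\<^sup>+(F) G\<close> is the product of \<open>B\<^sup>+(F)\<close> and \<open>G\<close>, so multiplicativity and the condition on
  \<open>B\<^sup>+\<close> determine the values on the basis recursively.
\<close>

lemma is_Theta_unique:
  assumes "is_Theta \<Theta>"
  shows "\<Theta> = bintree_relabel"
proof
  have lin: "klinear \<Theta>" and unit: "\<Theta> (basis []) = basis Triv"
    and mult: "\<And>a b. \<Theta> (conc a b) = under_prod (\<Theta> a) (\<Theta> b)"
    and graft: "\<And>F. \<Theta> (basis [Bplus F]) = graft (\<Theta> (basis F) \<otimes> basis Triv)"
    using assms by (simp_all add: is_Theta_def unitary_algebra_iso_def)
  have "\<Theta> (basis F) = basis (bintree_of F)" for F
  proof (induction F rule: bintree_of.induct)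
    case (2 F G)
    have "\<Theta> (basis (Bplus F # G)) = under_prod (\<Theta> (basis [Bplus F])) (\<Theta> (basis G))"
      by (simp flip: mult)
    also have "\<dots> = basis (bintree_of (Bplus F # G))"
      by (simp add: graft 2 under_prod_def)
    finally show ?case .
  qed (simp add: unit)
  then show "\<Theta> p = bintree_relabel p" for p
    by - (rule klinear_eqI[OF lin klinear_bintree_relabel], simp)
qed

lemma bintree_relabel_coproduct:
  fixes p :: "forest \<Rightarrow>\<^sub>0 'k::{comm_ring,comm_monoid_mult}"
  shows "tensor_map bintree_relabel bintree_relabel (coproduct_RT p) = coproduct_LR (bintree_relabel p)"
  unfolding coproduct_LR_eq_cut_coproduct coproduct_RT_eq_cut_coproduct
proof (rule klinear_eqI[where p = p])
  note lin = klinear_tensor_map klinear_cut_coproduct klinear_bintree_relabel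
  show "klinear (\<lambda>p::forest \<Rightarrow>\<^sub>0 'k. tensor_map bintree_relabel bintree_relabel (cut_coproduct forest_cuts p))"
    by (rule klinear_comp[OF lin(1) lin(2)])
  show "klinear (\<lambda>p::forest \<Rightarrow>\<^sub>0 'k. cut_coproduct cuts (bintree_relabel p))"
    by (rule klinear_comp[OF lin(2) lin(3)])
  show "tensor_map bintree_relabel bintree_relabel (cut_coproduct forest_cuts (basis F))
    = cut_coproduct cuts (bintree_relabel (basis F))" for F
    by (simp add: cut_coproduct_basis forest_cuts_def split_def o_def klinear_sum_list[OF lin(1)])
qed

theorem theorem4p4:
  "(\<exists>!\<Theta> :: (forest \<Rightarrow>\<^sub>0 'k::{comm_ring,comm_monoid_mult}) \<Rightarrow> (bintree \<Rightarrow>\<^sub>0 'k). is_Theta \<Theta>) \<and>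
   (\<forall>\<Theta> :: (forest \<Rightarrow>\<^sub>0 'k) \<Rightarrow> (bintree \<Rightarrow>\<^sub>0 'k). is_Theta \<Theta> \<longrightarrow>
      unitary_inf_bialgebra_iso conc (basis []) coproduct_RT under_prod (basis Triv) coproduct_LR \<Theta>)"
proof (intro conjI allI impI ex1I)
  show "is_Theta bintree_relabel" by (rule is_Theta_bintree_relabel)
  fix \<Theta> :: "(forest \<Rightarrow>\<^sub>0 'k) \<Rightarrow> (bintree \<Rightarrow>\<^sub>0 'k)"
  assume \<Theta>: "is_Theta \<Theta>"
  show "\<Theta> = bintree_relabel" by (rule is_Theta_unique[OF \<Theta>])
  with \<Theta> show "unitary_inf_bialgebra_iso conc (basis []) coproduct_RT
      under_prod (basis Triv) coproduct_LR \<Theta>"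
    by (simp add: unitary_inf_bialgebra_iso_def unitary_inf_bialgebra_RT unitary_inf_bialgebra_LR
        is_Theta_def bintree_relabel_coproduct)
qed

end
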